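(* For every integer $n\ge 1$, $\widehat{p}(K_{2,n})=p(K_{2,n})$, and this common value is $n$ if $n$ is even and $n+1$ if $n$ is odd.
   Context: $K_{m,n}$ is the complete bipartite graph with partite sets of sizes $m$ and $n$. An edge-coloring of a graph $G$ is any assignment of colors to its edges. A walk is closed if its two endpoints coincide, and open otherwise. A parity walk (in an edge-coloring) is a walk along which every color is used an even number of times (counting repeated traversals). A parity path is a parity walk that is a path with at least one edge. A parity edge-coloring is an edge-coloring having no parity path, and $p(G)$ is the minimum number of colors in a parity edge-coloring of $G$. A strong parity edge-coloring (spec) is an edge-coloring in which every parity walk is closed, and $\widehat{p}(G)$ is the minimum number of colors in a spec of $G$. *)

theory Defs
  imports "Graph_Theory.Kuratowski" "Graph_Theory.Vertex_Walk"
begin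

text \<open>
  As in the Graph_Theory library, an undirected graph is a symmetric digraph: the edge between
  \<open>u\<close> and \<open>v\<close> is present as the two arcs from \<open>u\<close> to \<open>v\<close> and from \<open>v\<close> to \<open>u\<close>.
  Edge-colorings are defined on the unordered pairs \<open>{u, v}\<close>, so both arcs get the same color.
  An edge-coloring is a total function on vertex sets; only its values on \<open>uedges G\<close> matter.
\<close>

definition uedges :: "('a, 'b) pre_digraph \<Rightarrow> 'a set set" where
  "uedges G = (\<lambda>(u, v). {u, v}) ` arcs_ends G"

text \<open>
  A walk is a nonempty vertex list (\<^const>\<open>vwalk\<close>); consecutive vertices give its edges.
  The one-vertex walk has no edges, hence is a (closed) parity walk.
\<close>

definition walk_colors :: "('a set \<Rightarrow> 'c) \<Rightarrow> 'a vwalk \<Rightarrow> 'c list" where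
  "walk_colors c p = map (\<lambda>(u, v). c {u, v}) (vwalk_arcs p)"

definition closed_walk :: "'a vwalk \<Rightarrow> bool" where
  "closed_walk p \<longleftrightarrow> hd p = last p"

definition parity_walk :: "('a, 'b) pre_digraph \<Rightarrow> ('a set \<Rightarrow> 'c) \<Rightarrow> 'a vwalk \<Rightarrow> bool" where
  "parity_walk G c p \<longleftrightarrow> vwalk p G \<and> (\<forall>x. even (count_list (walk_colors c p) x))"

definition parity_path :: "('a, 'b) pre_digraph \<Rightarrow> ('a set \<Rightarrow> 'c) \<Rightarrow> 'a vwalk \<Rightarrow> bool" where
  "parity_path G c p \<longleftrightarrow> parity_walk G c p \<and> vpath p G \<and> vwalk_length p \<ge> 1"

definition parity_edge_coloring :: "('a, 'b) pre_digraph \<Rightarrow> ('a set \<Rightarrow> 'c) \<Rightarrow> bool" where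
  "parity_edge_coloring G c \<longleftrightarrow> (\<nexists>p. parity_path G c p)"

definition strong_parity_edge_coloring :: "('a, 'b) pre_digraph \<Rightarrow> ('a set \<Rightarrow> 'c) \<Rightarrow> bool" where
  "strong_parity_edge_coloring G c \<longleftrightarrow> (\<forall>p. parity_walk G c p \<longrightarrow> closed_walk p)"

text \<open>
  Natural numbers suffice as colors because the graphs are finite. For a finite graph the minima
  are attained, since coloring all edges differently gives a strong parity edge-coloring.
\<close>

definition parity_number :: "('a, 'b) pre_digraph \<Rightarrow> nat" where
  "parity_number G =
    (LEAST k. \<exists>c :: 'a set \<Rightarrow> nat. parity_edge_coloring G c \<and> card (c ` uedges G) = k)"

definition strong_parity_number :: "('a, 'b) pre_digraph \<Rightarrow> nat" where
  "strong_parity_number G =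
    (LEAST k. \<exists>c :: 'a set \<Rightarrow> nat. strong_parity_edge_coloring G c \<and> card (c ` uedges G) = k)"

end

theory Submission
  imports Defs
begin

text \<open>
  Upper bound: label the vertices injectively by natural numbers and give each edge the bitwise
  \<open>XOR\<close> of the labels of its ends. The \<open>XOR\<close> of the colors along a walk is the \<open>XOR\<close> of the labels
  of its two ends, and it vanishes on a parity walk, so parity walks are closed. Labelling the two
  vertices of the small side by 0 and 1, and the other side by \<open>2, \<dots>, n + 1\<close>, the colors lie in
  \<open>{2, \<dots>, n + 1}\<close> or, for odd \<open>n\<close>, in \<open>{2, \<dots>, n + 2}\<close>.

  Lower bound: let \<open>x\<close> and \<open>y\<close> be the vertices of the small side. The \<open>n\<close> edges at \<open>x\<close> have
  distinct colors. If there are no further colors, every color occurs once at \<open>x\<close> and once at \<open>y\<close>,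
  so the vertex \<open>v\<close> determines a vertex \<open>w\<close> such that \<open>xw\<close> and \<open>yv\<close> have the same color. As paths
  with two edges and with four edges \<open>i, x, j, y, k\<close> are not parity paths, this is an involution
  without fixed points, and \<open>n\<close> is even.
\<close>

unbundle bit_operations_syntax

text \<open>Removing an orbit \<open>{a, f a}\<close> lowers the cardinality by two and leaves a set
  that is still closed under \<open>f\<close>.\<close>

lemma even_card_involution:
  assumes "finite A"
    and "\<And>a. a \<in> A \<Longrightarrow> f a \<in> A"
    and "\<And>a. a \<in> A \<Longrightarrow> f a \<noteq> a"
    and "\<And>a. a \<in> A \<Longrightarrow> f (f a) = a"
  shows "even (card A)"
  using assms
proof (induction A rule: finite_psubset_induct)
  case (psubset A)
  show ?case
  proof (cases "A = {}")
    case False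
    then obtain a where a: "a \<in> A" by blast
    let ?B = "A - {a, f a}"
    have "f b \<in> ?B" if "b \<in> ?B" for b
    proof -
      have "f b \<noteq> a" and "f b \<noteq> f a"
        using that a psubset.prems(3)[of b] psubset.prems(3)[of a] by auto
      then show ?thesis
        using that psubset.prems(1) by blast
    qed
    then have "even (card ?B)"
      using a psubset.prems by (intro psubset.IH) auto
    moreover have "{a, f a} \<subseteq> A" and "card {a, f a} = 2"
      using a psubset.prems(1)[of a] psubset.prems(2)[of a] by auto
    then have "card ?B = card A - 2" and "card A \<ge> 2"
      using psubset.hyps card_mono[of A "{a, f a}"] by (simp_all only: card_Diff_subset finite.intros)
    ultimately show ?thesis by simp
  qed simp
qed

subsection \<open>Edge-colorings from vertex labels\<close>

text \<open>Edges are unordered pairs, so the ends are picked by choice; commutativity of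
  \<open>XOR\<close> makes the choice irrelevant.\<close>

definition xor_coloring :: "('a \<Rightarrow> nat) \<Rightarrow> 'a set \<Rightarrow> nat" where
  "xor_coloring f e = (SOME z. \<exists>u v. e = {u, v} \<and> z = f u XOR f v)"

lemma xor_coloring_doubleton: "xor_coloring f {u, v} = f u XOR f v"
  unfolding xor_coloring_def
  by (rule some_equality) (auto simp: doubleton_eq_iff xor.commute)

definition xor_list :: "nat list \<Rightarrow> nat" where
  "xor_list xs = foldr (XOR) xs 0"

lemma xor_list_simps [simp]:
  "xor_list [] = 0"
  "xor_list (x # xs) = x XOR xor_list xs"
  by (simp_all add: xor_list_def)

lemma bit_xor_list: "bit (xor_list xs) i \<longleftrightarrow> odd (length (filter (\<lambda>x. bit x i) xs))"
  by (induction xs) (auto simp: bit_xor_iff)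

text \<open>The length is the sum of the multiplicities of the distinct entries satisfying
  \<open>P\<close>. With \<open>P\<close> testing a single bit, this makes that bit of the
  \<open>XOR\<close> vanish.\<close>

lemma even_length_filter_of_count_list:
  assumes "\<And>x. even (count_list xs x)"
  shows "even (length (filter P xs))"
proof -
  have "length (filter P xs) = (\<Sum>x\<in>set (filter P xs). count_list (filter P xs) x)"
    by (simp add: sum_count_set)
  also have "\<dots> = (\<Sum>x\<in>set (filter P xs). count_list xs x)"
    by (intro sum.cong)
      (auto simp: count_list_eq_length_filter conj_commute
        intro: arg_cong[where f = length] filter_cong)
  finally show ?thesis
    using assms by (simp add: dvd_sum)
qed

lemma xor_list_eq_0:
  assumes "\<And>x. even (count_list xs x)"
  shows "xor_list xs = 0"
  by (rule bit_eqI) (use even_length_filter_of_count_list[OF assms] in \<open>simp add: bit_xor_list\<close>)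

lemma xor_list_walk_colors:
  "p \<noteq> [] \<Longrightarrow> xor_list (walk_colors (xor_coloring f) p) = f (hd p) XOR f (last p)"
proof (induction p rule: vwalk_arcs.induct)
  case (3 x y xs)
  have "f x XOR f y XOR (f y XOR z) = f x XOR z" for z
    by (metis xor.assoc xor_self_eq xor.left_neutral)
  with 3 show ?case
    by (simp add: walk_colors_def xor_coloring_doubleton xor.assoc)
qed (simp_all add: walk_colors_def)

lemma strong_parity_xor_coloring:
  assumes "inj_on f (verts G)"
  shows "strong_parity_edge_coloring G (xor_coloring f)"
  unfolding strong_parity_edge_coloring_def closed_walk_def
proof (intro allI impI)
  fix p assume p: "parity_walk G (xor_coloring f) p"
  then have "p \<noteq> []" and verts: "set p \<subseteq> verts G"
    by (auto simp: parity_walk_def vwalk_def)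
  moreover have "xor_list (walk_colors (xor_coloring f) p) = 0"
    using p by (intro xor_list_eq_0) (simp add: parity_walk_def)
  ultimately have "f (hd p) XOR f (last p) = 0"
    using xor_list_walk_colors by metis
  then have "f (hd p) = f (last p)"
    by (metis xor.assoc xor_self_eq xor.left_neutral xor.right_neutral)
  then show "hd p = last p"
    using assms verts \<open>p \<noteq> []\<close> by (auto dest!: inj_onD)
qed

text \<open>A path with an edge has distinct ends, so it is open.\<close>

lemma strong_parity_imp_parity_edge_coloring:
  assumes "strong_parity_edge_coloring G c"
  shows "parity_edge_coloring G c"
  unfolding parity_edge_coloring_def
proof
  assume "\<exists>p. parity_path G c p"
  then obtain p where "parity_walk G c p" "distinct p" "length p \<ge> 2"
    by (auto simp: parity_path_def vpath_def)
  moreover from this have "hd p = last p"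
    using assms by (auto simp: strong_parity_edge_coloring_def closed_walk_def)
  ultimately show False
    by (cases p) (auto split: if_splits)
qed

subsection \<open>Complete bipartite graphs with a side of size two\<close>

lemma uedges_bipartite:
  assumes "arcs_ends G = U \<times> V \<union> V \<times> U"
  shows "uedges G = (\<Union>u\<in>U. \<Union>v\<in>V. {{u, v}})"
  unfolding uedges_def assms by (auto simp: insert_commute)

lemma ex_strong_parity_edge_coloring:
  assumes verts: "verts G = {x, y} \<union> V" "{x, y} \<inter> V = {}" "x \<noteq> y"
    and V: "finite V" "card V = n"
    and arcs: "arcs_ends G = {x, y} \<times> V \<union> V \<times> {x, y}"
  obtains c :: "'a set \<Rightarrow> nat"
  where "strong_parity_edge_coloring G c"
    and "card (c ` uedges G) \<le> (if even n then n else n + 1)"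
proof -
  obtain g where g: "bij_betw g V {2..<n + 2}"
    using V by (metis finite_same_card_bij finite_atLeastLessThan card_atLeastLessThan add_diff_cancel_right')
  define f where "f v = (if v = x then 0 else if v = y then 1 else g v)" for v
  have f_V: "f v = g v" "g v \<in> {2..<n + 2}" if "v \<in> V" for v
    using that verts(2) bij_betwE[OF g] by (auto simp: f_def)
  have f_xy: "f x = 0" "f y = 1"
    using verts(3) by (auto simp: f_def)
  have "inj_on f V"
    using g f_V(1) by (simp add: bij_betw_def inj_on_def)
  then have "inj_on f (verts G)"
    unfolding verts(1) using verts(2) f_V f_xy by (auto simp: inj_on_Un) fastforce+
  moreover let ?m = "if even n then n else n + 1"
  have "xor_coloring f ` uedges G \<subseteq> {2..<?m + 2}"
  proof -
    have "f u XOR f v \<in> {2..<?m + 2}" if "u \<in> {x, y}" "v \<in> V" for u v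
    proof -
      define k where "k = g v"
      have k: "2 \<le> k" "k < n + 2"
        using f_V(2)[OF that(2)] by (auto simp: k_def)
      define z where "z = f u XOR f v"
      have "f u = 0 \<or> f u = 1" and "f v = k"
        using that f_V(1) f_xy by (auto simp: k_def)
      \<comment> \<open>\<open>XOR\<close> with 1 flips the last bit, swapping \<open>2 * i\<close>
        and \<open>2 * i + 1\<close>. Only the largest label \<open>n + 1\<close> can leave the
        range of labels, namely when \<open>n\<close> is odd; this costs the extra color
        \<open>n + 2\<close>.\<close>
      then have "z = k \<or> even k \<and> z = k + 1 \<or> odd k \<and> z = k - 1"
        by (cases "even k") (auto simp: z_def Suc_0_xor_eq)
      with k have "2 \<le> z \<and> z < ?m + 2"
        by (cases "even n"; simp; presburger)
      then show ?thesis
        by (simp add: z_def)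
    qed
    then show ?thesis
      by (auto simp: uedges_bipartite[OF arcs] xor_coloring_doubleton)
  qed
  then have "card (xor_coloring f ` uedges G) \<le> ?m"
    using card_mono[of "{2..<?m + 2}"] by fastforce
  ultimately show thesis
    using strong_parity_xor_coloring that by blast
qed

lemma parity_edge_coloring_card_ge:
  assumes verts: "verts G = {x, y} \<union> V" "{x, y} \<inter> V = {}" "x \<noteq> y"
    and V: "finite V" "card V = n"
    and arcs: "arcs_ends G = {x, y} \<times> V \<union> V \<times> {x, y}"
    and c: "parity_edge_coloring G c"
  shows "card (c ` uedges G) \<ge> (if even n then n else n + 1)"
proof (rule ccontr)
  let ?C = "c ` uedges G"
  define a where "a v = c {x, v}" for v
  define b where "b v = c {y, v}" for v
  have C: "?C = a ` V \<union> b ` V"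
    by (auto simp: uedges_bipartite[OF arcs] a_def b_def)
  have no_path: "\<not> parity_path G c p" for p
    using c by (auto simp: parity_edge_coloring_def)
  note path_simps = parity_path_def parity_walk_def vpath_def vwalk_def walk_colors_def
    verts(1) arcs a_def b_def insert_commute
  have inj_a: "inj_on a V"
  proof (rule inj_onI, rule ccontr)
    fix v w assume "v \<in> V" "w \<in> V" "a v = a w" "v \<noteq> w"
    then show False
      using no_path[of "[v, x, w]"] verts by (auto simp: path_simps split: if_splits)
  qed
  have inj_b: "inj_on b V"
  proof (rule inj_onI, rule ccontr)
    fix v w assume "v \<in> V" "w \<in> V" "b v = b w" "v \<noteq> w"
    then show False
      using no_path[of "[v, y, w]"] verts by (auto simp: path_simps split: if_splits)
  qed
  have neq: "a v \<noteq> b v" if "v \<in> V" for v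
    using no_path[of "[x, v, y]"] verts that by (auto simp: path_simps split: if_splits)
  have cycle: "i = k" if "i \<in> V" "j \<in> V" "k \<in> V" "b j = a i" "b k = a j" for i j k
  proof (rule ccontr)
    assume "i \<noteq> k"
    \<comment> \<open>Equality would give a vertex \<open>v\<close> with \<open>a v = b v\<close>.
      The path below then has colors \<open>a i\<close>, \<open>a j\<close>, \<open>b j\<close>,
      \<open>b k\<close>, which match in pairs.\<close>
    moreover have "i \<noteq> j" "j \<noteq> k"
      using that neq by metis+
    ultimately show False
      using no_path[of "[i, x, j, y, k]"] verts that by (auto simp: path_simps split: if_splits)
  qed
  assume "\<not> ?thesis"
  moreover have "card (a ` V) = n" "card (b ` V) = n"
    using inj_a inj_b V by (simp_all add: card_image)
  moreover have "finite ?C"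
    using V by (simp add: C)
  moreover from this have "card (a ` V) \<le> card ?C"
    by (intro card_mono) (auto simp: C)
  ultimately have "odd n" and "card ?C = n"
    by (auto split: if_splits)
  then have "a ` V = ?C"
    using \<open>card (a ` V) = n\<close> \<open>finite ?C\<close> by (intro card_subset_eq) (auto simp: C)
  moreover have "b ` V = ?C"
    using \<open>card (b ` V) = n\<close> \<open>card ?C = n\<close> \<open>finite ?C\<close> by (intro card_subset_eq) (auto simp: C)
  ultimately have "b ` V = a ` V" by simp
  define f where "f v = inv_into V a (b v)" for v
  have f: "f v \<in> V" "a (f v) = b v" if "v \<in> V" for v
    using that \<open>b ` V = a ` V\<close> unfolding f_def
    by (metis imageI inv_into_into, metis imageI f_inv_into_f)
  have "even (card V)"
  proof (rule even_card_involution[of V f])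
    fix v assume v: "v \<in> V"
    show "f v \<noteq> v"
      using f[OF v] neq[OF v] by auto
    \<comment> \<open>Here \<open>b v = a (f v)\<close> and \<open>b (f v) = a (f (f v))\<close>, so
      \<open>cycle\<close> applies.\<close>
    show "f (f v) = v"
      using cycle[of "f (f v)" "f v" v] f v by simp
  qed (use V f in auto)
  with \<open>odd n\<close> V show False by simp
qed

theorem corollary4p7:
  fixes G :: "('a, 'b) pre_digraph" and n :: nat
  assumes "n \<ge> 1"
    and "complete_bipartite_digraph 2 n G"
  shows "strong_parity_number G = parity_number G \<and>
    parity_number G = (if even n then n else n + 1)"
proof -
  let ?m = "if even n then n else n + 1"
  obtain U V where UV: "verts G = U \<union> V" "U \<inter> V = {}" "card U = 2" "card V = n"
    "arcs_ends G = U \<times> V \<union> V \<times> U"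
    using assms(2) by (auto simp: complete_bipartite_digraph_def)
  obtain x y where U: "U = {x, y}" "x \<noteq> y"
    using UV(3) by (auto simp: card_2_iff)
  \<comment> \<open>An infinite set has \<open>card\<close> 0, which \<open>n \<ge> 1\<close>
    excludes.\<close>
  have V: "finite V"
    using assms(1) UV(4) card.infinite by fastforce
  note bip = UV(1,2)[unfolded U(1)] U(2) V UV(4) UV(5)[unfolded U(1)]
  note lower = parity_edge_coloring_card_ge[OF bip]
  obtain c :: "'a set \<Rightarrow> nat"
    where spec: "strong_parity_edge_coloring G c" and le: "card (c ` uedges G) \<le> ?m"
    by (rule ex_strong_parity_edge_coloring[OF bip])
  note pec = strong_parity_imp_parity_edge_coloring[OF spec]
  have card: "card (c ` uedges G) = ?m"
    using le lower[OF pec] by (rule le_antisym)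
  have "strong_parity_number G = ?m"
    unfolding strong_parity_number_def
    by (rule Least_equality) (use spec card lower strong_parity_imp_parity_edge_coloring in blast)+
  moreover have "parity_number G = ?m"
    unfolding parity_number_def
    by (rule Least_equality) (use pec card lower in blast)+
  ultimately show ?thesis by simp
qed

end
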